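(* Let $\mathcal{J}(z)=\sum_{n\ge 0} |\mathcal{S}_n\cap Av(\mathbf{4123},\mathbf{1243},\mathbf{1423})|\, z^n$ be the generating function for the class $Av(\mathbf{4123},\mathbf{1243},\mathbf{1423})$. Then $$\mathcal{J}(z) = \frac{1+z-\sqrt{1-6z+5z^2}}{2(2z-z^2)}.$$
   Context: A permutation $\sigma$ contains a pattern $\pi$ if some subsequence of $\sigma$ is order-isomorphic to $\pi$; otherwise $\sigma$ avoids $\pi$. For a set $B$ of patterns, $Av(B)$ is the set of permutations avoiding every element of $B$, and $\mathcal{S}_n$ is the set of permutations of length $n$ (the empty permutation is counted for $n=0$). *)

theory Defs
  imports
    "HOL-Library.Sublist"
    "HOL-Combinatorics.Multiset_Permutations"
    "HOL-Computational_Algebra.Formal_Power_Series"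
begin

(* Permutations are in one-line notation: a permutation of length n is a list that
   contains each of 1, ..., n exactly once. *)
definition perms :: "nat \<Rightarrow> nat list set" where
  "perms n = permutations_of_set {1..n}"

definition order_isomorphic :: "nat list \<Rightarrow> nat list \<Rightarrow> bool" where
  "order_isomorphic xs ys \<longleftrightarrow> length xs = length ys \<and>
     (\<forall>i<length xs. \<forall>j<length xs. xs ! i < xs ! j \<longleftrightarrow> ys ! i < ys ! j)"

definition contains_pattern :: "nat list \<Rightarrow> nat list \<Rightarrow> bool" where
  "contains_pattern \<sigma> \<pi> \<longleftrightarrow> (\<exists>\<tau>. subseq \<tau> \<sigma> \<and> order_isomorphic \<tau> \<pi>)"

definition Av :: "nat list set \<Rightarrow> nat list set" where
  "Av B = {\<sigma> \<in> (\<Union>n. perms n). \<forall>\<pi>\<in>B. \<not> contains_pattern \<sigma> \<pi>}"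

definition perm_gf :: "nat list set \<Rightarrow> real fps" where
  "perm_gf C = Abs_fps (\<lambda>n. of_nat (card (perms n \<inter> C)))"

(* The power series square root with constant term sqrt (fps_nth f 0); it is a square root of f
   whenever fps_nth f 0 > 0. *)
definition fps_sqrt :: "real fps \<Rightarrow> real fps" where
  "fps_sqrt = fps_radical root 2"

lemma fps_sqrt_power2:
  assumes "fps_nth f 0 > 0"
  shows "fps_sqrt f ^ 2 = f"
proof -
  have "root (Suc 1) (fps_nth f 0) ^ Suc 1 = fps_nth f 0"
    using assms by (intro real_root_pow_pos2) auto
  then have "fps_radical root (Suc 1) f ^ Suc 1 = f"
    using power_radical[of f root 1] assms by (metis less_irrefl)
  then show ?thesis
    by (simp add: fps_sqrt_def numeral_2_eq_2)
qed

(* Division of power series truncates when the subdegree of the denominator exceeds that of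
   the numerator. For the quotient below it is exact. *)
lemma fps_quotient_exact:
  fixes N D :: "real fps"
  defines "N \<equiv> 1 + fps_X - fps_sqrt (1 - 6 * fps_X + 5 * fps_X ^ 2)"
    and "D \<equiv> 2 * (2 * fps_X - fps_X ^ 2)"
  shows "D \<noteq> 0" and "N / D * D = N"
proof -
  have D1: "fps_nth D 1 \<noteq> 0"
    by (simp add: D_def numeral_fps_const fps_X_power_iff)
  then show D0: "D \<noteq> 0" by auto
  have "subdegree D \<le> 1" using D1 by (rule subdegree_leI)
  moreover have "fps_nth N 0 = 0"
    by (simp add: N_def fps_sqrt_def)
  ultimately have "D dvd N"
    using D0 by (cases "N = 0")
      (auto simp: fps_dvd_iff intro!: order.trans[OF \<open>subdegree D \<le> 1\<close>] subdegree_geI)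
  then show "N / D * D = N" by simp
qed

end

(* The three patterns are 123 with a 4 inserted anywhere before the 3, so a permutation avoids
   them iff every entry that ends a 123 is a left-to-right maximum. Hence inserting a new maximum
   into a permutation of the class stays in the class iff the new entry is placed after all ends
   of 123s. The resulting generating tree needs only two parameters: the number k of admissible
   sites once a 123 is present, and the length r of the initial decreasing run before that.
   With y = 1 / (1 - z), the generating function of the descendants of a permutation of length n
   is y^k in the first case and y^(n - r) H(r) in the second, where
     H(r) = 1 + z (H(r + 1) + (SUM p = 1..r. y^(r + 1 - p) H(p))).
   This is a linear recurrence with the characteristic equation z q^2 - q + y = 0. Choosing the
   root q that is a power series, H(0) is the claimed generating function. *)

theory Submission
  imports Defs
begin

section \<open>Statistics of the generating tree\<close>

definition has_ascent :: "nat list \<Rightarrow> nat \<Rightarrow> bool" where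
  "has_ascent \<sigma> p \<longleftrightarrow> (\<exists>j<p. \<exists>i<j. \<sigma> ! i < \<sigma> ! j)"

definition ends_123 :: "nat list \<Rightarrow> nat \<Rightarrow> bool" where
  "ends_123 \<sigma> k \<longleftrightarrow> k < length \<sigma> \<and> (\<exists>j<k. \<exists>i<j. \<sigma> ! i < \<sigma> ! j \<and> \<sigma> ! j < \<sigma> ! k)"

definition ends_maximal :: "nat list \<Rightarrow> bool" where
  "ends_maximal \<sigma> \<longleftrightarrow> (\<forall>k. ends_123 \<sigma> k \<longrightarrow> (\<forall>l<k. \<sigma> ! l \<le> \<sigma> ! k))"

text \<open>Position 0 is returned when no entry ends a 123; otherwise one more than the index of the last
  such entry.\<close>
definition first_site :: "nat list \<Rightarrow> nat" where
  "first_site \<sigma> = (LEAST e. \<forall>k\<ge>e. \<not> ends_123 \<sigma> k)"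

text \<open>For distinct entries this is the length of the longest decreasing prefix, because the
  two entries of an ascent need not be neighbours. The bound by the length keeps
  \<open>has_ascent\<close> from reading past the end of the list.\<close>

definition initial_run :: "nat list \<Rightarrow> nat" where
  "initial_run \<sigma> = (GREATEST p. p \<le> length \<sigma> \<and> \<not> has_ascent \<sigma> p)"

definition insert_at :: "nat \<Rightarrow> nat \<Rightarrow> nat list \<Rightarrow> nat list" where
  "insert_at p x \<sigma> = take p \<sigma> @ x # drop p \<sigma>"

lemma has_ascentI: "i < j \<Longrightarrow> j < p \<Longrightarrow> \<sigma> ! i < \<sigma> ! j \<Longrightarrow> has_ascent \<sigma> p"
  unfolding has_ascent_def by blast

lemma ends_123I:
  "i < j \<Longrightarrow> j < k \<Longrightarrow> k < length \<sigma> \<Longrightarrow> \<sigma> ! i < \<sigma> ! j \<Longrightarrow> \<sigma> ! j < \<sigma> ! k \<Longrightarrow> ends_123 \<sigma> k"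
  unfolding ends_123_def by blast

section \<open>Patterns of length four in terms of positions\<close>

lemma subseq_Cons_iff_nth:
  "subseq (x # xs) ys \<longleftrightarrow> (\<exists>i<length ys. ys ! i = x \<and> subseq xs (drop (Suc i) ys))"
proof
  assume "subseq (x # xs) ys"
  then obtain us vs where "ys = us @ x # vs" "subseq xs vs"
    using list_emb_ConsD[of "(=)" x xs ys] by auto
  then show "\<exists>i<length ys. ys ! i = x \<and> subseq xs (drop (Suc i) ys)"
    by (intro exI[of _ "length us"]) auto
next
  assume "\<exists>i<length ys. ys ! i = x \<and> subseq xs (drop (Suc i) ys)"
  then obtain i where i: "i < length ys" "ys ! i = x" "subseq xs (drop (Suc i) ys)" by blast
  have "subseq (x # xs) (drop i ys)"
    using i by (simp add: Cons_nth_drop_Suc[symmetric])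
  then show "subseq (x # xs) ys"
    by (meson subseq_order.trans suffix_drop suffix_imp_subseq)
qed

lemma subseq_4_iff:
  "subseq [a, b, c, d] ys \<longleftrightarrow> (\<exists>l<length ys. \<exists>k<l. \<exists>j<k. \<exists>i<j.
     ys ! i = a \<and> ys ! j = b \<and> ys ! k = c \<and> ys ! l = d)" (is "?L \<longleftrightarrow> ?R")
proof
  assume ?L
  then obtain i j k l where
    "i < length ys" "j < length ys - Suc i" "k < length ys - Suc (Suc (i + j))"
    "l < length ys - Suc (Suc (Suc (i + j + k)))"
    "ys ! i = a" "ys ! Suc (i + j) = b" "ys ! Suc (Suc (i + j + k)) = c"
    "ys ! Suc (Suc (Suc (i + j + k + l))) = d"
    by (auto simp: subseq_Cons_iff_nth algebra_simps)
  moreover from this have "Suc (Suc (Suc (i + j + k + l))) < length ys" by linarith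
  moreover have "i < Suc (i + j)" "Suc (i + j) < Suc (Suc (i + j + k))"
    "Suc (Suc (i + j + k)) < Suc (Suc (Suc (i + j + k + l)))" by linarith+
  ultimately show ?R by blast
next
  assume ?R
  then obtain i j k l where *: "l < length ys" "k < l" "j < k" "i < j"
    "ys ! i = a" "ys ! j = b" "ys ! k = c" "ys ! l = d" by blast
  \<comment> \<open>Each offset is counted from the position just after the preceding index, which
    is how entries of the successive \<open>drop\<close>s are addressed.\<close>
  obtain j' k' l' where j': "j = Suc (i + j')" "k = Suc (j + k')" "l = Suc (k + l')"
    using * less_iff_Suc_add by metis
  have "subseq [d] (drop (Suc k) ys)"
    unfolding subseq_Cons_iff_nth using * j' by (intro exI[of _ l']) (auto simp: algebra_simps)
  then have "subseq [c, d] (drop (Suc j) ys)"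
    using * j' by (subst subseq_Cons_iff_nth, intro exI[of _ k']) (auto simp: algebra_simps)
  then have "subseq [b, c, d] (drop (Suc i) ys)"
    using * j' by (subst subseq_Cons_iff_nth, intro exI[of _ j']) (auto simp: algebra_simps)
  then show ?L
    using * by (subst subseq_Cons_iff_nth, intro exI[of _ i]) auto
qed

lemma contains_pattern_4I:
  assumes "i < j" "j < k" "k < l" "l < length \<sigma>"
    and iso: "order_isomorphic [\<sigma> ! i, \<sigma> ! j, \<sigma> ! k, \<sigma> ! l] \<pi>"
  shows "contains_pattern \<sigma> \<pi>"
proof -
  from assms(1-4) have "subseq [\<sigma> ! i, \<sigma> ! j, \<sigma> ! k, \<sigma> ! l] \<sigma>"
    unfolding subseq_4_iff by blast
  with iso show ?thesis unfolding contains_pattern_def by blast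
qed

lemma contains_pattern_4E:
  assumes "contains_pattern \<sigma> [p, q, r, s]"
  obtains i j k l where "i < j" "j < k" "k < l" "l < length \<sigma>"
    "order_isomorphic [\<sigma> ! i, \<sigma> ! j, \<sigma> ! k, \<sigma> ! l] [p, q, r, s]"
proof -
  obtain \<tau> where \<tau>: "subseq \<tau> \<sigma>" "order_isomorphic \<tau> [p, q, r, s]"
    using assms by (auto simp: contains_pattern_def)
  then have "length \<tau> = Suc (Suc (Suc (Suc 0)))" by (simp add: order_isomorphic_def)
  then obtain a b c d where "\<tau> = [a, b, c, d]" by (auto simp: length_Suc_conv)
  with \<tau> that show thesis by (auto simp: subseq_4_iff)
qed

lemma order_isomorphic_patterns:
  "order_isomorphic [a, b, c, d] [4, 1, 2, 3] \<longleftrightarrow> b < c \<and> c < d \<and> d < a"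
  "order_isomorphic [a, b, c, d] [1, 4, 2, 3] \<longleftrightarrow> a < c \<and> c < d \<and> d < b"
  "order_isomorphic [a, b, c, d] [1, 2, 4, 3] \<longleftrightarrow> a < b \<and> b < d \<and> d < c"
  by (auto simp: order_isomorphic_def All_less_Suc numeral_eq_Suc)

text \<open>In each of the three patterns the 3 ends a 123 and the 4 is a larger entry before it.
  Conversely, if an entry at \<open>l < k\<close> exceeds the end of a 123 at positions
  \<open>i\<close>, \<open>j\<close>, \<open>k\<close>, then the place of \<open>l\<close> relative
  to \<open>i\<close> and \<open>j\<close> decides which of 4123, 1423 and 1243 occurs.\<close>

lemma ends_maximal_iff_avoids:
  "ends_maximal \<sigma> \<longleftrightarrow> (\<forall>\<pi>\<in>{[4,1,2,3], [1,2,4,3], [1,4,2,3]}. \<not> contains_pattern \<sigma> \<pi>)"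
  (is "?L \<longleftrightarrow> ?R")
proof
  assume L: ?L
  have *: "\<sigma> ! m \<le> \<sigma> ! l" if "l < length \<sigma>" "j < l" "i < j" "m < l" "\<sigma> ! i < \<sigma> ! j" "\<sigma> ! j < \<sigma> ! l"
    for i j l m
    using L that unfolding ends_maximal_def ends_123_def by blast
  have "\<not> contains_pattern \<sigma> [4,1,2,3]"
  proof
    assume "contains_pattern \<sigma> [4,1,2,3]"
    then obtain i j k l where "l < length \<sigma>" "k < l" "j < k" "i < j"
      "\<sigma> ! j < \<sigma> ! k" "\<sigma> ! k < \<sigma> ! l" "\<sigma> ! l < \<sigma> ! i"
      by (elim contains_pattern_4E, unfold order_isomorphic_patterns) blast
    then show False using *[of l k j i] by simp
  qed
  moreover have "\<not> contains_pattern \<sigma> [1,2,4,3]"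
  proof
    assume "contains_pattern \<sigma> [1,2,4,3]"
    then obtain i j k l where "l < length \<sigma>" "k < l" "j < k" "i < j"
      "\<sigma> ! i < \<sigma> ! j" "\<sigma> ! j < \<sigma> ! l" "\<sigma> ! l < \<sigma> ! k"
      by (elim contains_pattern_4E, unfold order_isomorphic_patterns) blast
    then show False using *[of l j i k] by simp
  qed
  moreover have "\<not> contains_pattern \<sigma> [1,4,2,3]"
  proof
    assume "contains_pattern \<sigma> [1,4,2,3]"
    then obtain i j k l where "l < length \<sigma>" "k < l" "j < k" "i < j"
      "\<sigma> ! i < \<sigma> ! k" "\<sigma> ! k < \<sigma> ! l" "\<sigma> ! l < \<sigma> ! j"
      by (elim contains_pattern_4E, unfold order_isomorphic_patterns) blast
    then show False using *[of l k i j] by simp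
  qed
  ultimately show ?R by simp
next
  assume R: ?R
  show ?L
    unfolding ends_maximal_def ends_123_def
  proof (intro allI impI, elim conjE exE)
    fix k l i j
    assume h: "l < k" "k < length \<sigma>" "j < k" "i < j" "\<sigma> ! i < \<sigma> ! j" "\<sigma> ! j < \<sigma> ! k"
    show "\<sigma> ! l \<le> \<sigma> ! k"
    proof (rule ccontr)
      assume "\<not> \<sigma> ! l \<le> \<sigma> ! k"
      then have gt: "\<sigma> ! k < \<sigma> ! l" by simp
      with h have "l \<noteq> i" "l \<noteq> j" by auto
      then consider "l < i" | "i < l" "l < j" | "j < l" by linarith
      then show False
      proof cases
        case 1
        then have "contains_pattern \<sigma> [4,1,2,3]"
          using h gt by (intro contains_pattern_4I[of l i j k], unfold order_isomorphic_patterns) auto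
        with R show False by simp
      next
        case 2
        then have "contains_pattern \<sigma> [1,4,2,3]"
          using h gt by (intro contains_pattern_4I[of i l j k], unfold order_isomorphic_patterns) auto
        with R show False by simp
      next
        case 3
        then have "contains_pattern \<sigma> [1,2,4,3]"
          using h gt by (intro contains_pattern_4I[of i j l k], unfold order_isomorphic_patterns) auto
        with R show False by simp
      qed
    qed
  qed
qed

section \<open>Insertion, and the two statistics as thresholds\<close>

lemma length_insert_at [simp]: "length (insert_at p x \<sigma>) = Suc (length \<sigma>)"
  by (simp add: insert_at_def)

lemma nth_insert_at:
  assumes "p \<le> length \<sigma>" "i \<le> length \<sigma>"
  shows "insert_at p x \<sigma> ! i = (if i < p then \<sigma> ! i else if i = p then x else \<sigma> ! (i - 1))"
proof -
  consider "i < p" | "i = p" | d where "i = Suc (p + d)"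
    by (metis less_iff_Suc_add nat_neq_iff)
  then show ?thesis using assms by cases (auto simp: insert_at_def nth_append)
qed

lemma has_ascent_mono: "has_ascent \<sigma> p \<Longrightarrow> p \<le> q \<Longrightarrow> has_ascent \<sigma> q"
  unfolding has_ascent_def by (meson less_le_trans)

text \<open>By \<open>has_ascent_mono\<close> the lengths of ascent-free prefixes form an initial
  segment, and \<open>initial_run\<close> is its last element.\<close>

lemma initial_run:
  shows initial_run_le: "initial_run \<sigma> \<le> length \<sigma>"
    and has_ascent_iff: "p \<le> length \<sigma> \<Longrightarrow> has_ascent \<sigma> p \<longleftrightarrow> initial_run \<sigma> < p"
proof -
  let ?P = "\<lambda>p. p \<le> length \<sigma> \<and> \<not> has_ascent \<sigma> p"
  have P: "?P (initial_run \<sigma>)"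
    unfolding initial_run_def
    by (rule GreatestI_nat[of ?P 0 "length \<sigma>"]) (auto simp: has_ascent_def)
  then show "initial_run \<sigma> \<le> length \<sigma>" by simp
  have G: "q \<le> initial_run \<sigma>" if "?P q" for q
    unfolding initial_run_def
    by (rule Greatest_le_nat[of ?P q "length \<sigma>"]) (use that in auto)
  show "has_ascent \<sigma> p \<longleftrightarrow> initial_run \<sigma> < p" if "p \<le> length \<sigma>"
    using P G that has_ascent_mono not_le by blast
qed

lemma initial_run_eqI:
  assumes "r \<le> length \<sigma>" "\<And>p. p \<le> length \<sigma> \<Longrightarrow> has_ascent \<sigma> p \<longleftrightarrow> r < p"
  shows "initial_run \<sigma> = r"
  unfolding initial_run_def by (rule Greatest_equality) (use assms not_le in auto)

text \<open>The condition on the right passes to larger \<open>p\<close> and holds at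
  \<open>length \<sigma>\<close>, so it is equivalent to lying above its least solution.\<close>

lemma first_site_le_iff: "first_site \<sigma> \<le> p \<longleftrightarrow> (\<forall>k\<ge>p. \<not> ends_123 \<sigma> k)"
proof -
  let ?P = "\<lambda>e. \<forall>k\<ge>e. \<not> ends_123 \<sigma> k"
  have "?P (first_site \<sigma>)"
    unfolding first_site_def by (rule LeastI[of ?P "length \<sigma>"]) (auto simp: ends_123_def)
  moreover have "?P p \<Longrightarrow> first_site \<sigma> \<le> p"
    unfolding first_site_def by (rule Least_le)
  ultimately show ?thesis by (meson le_trans)
qed

lemma first_site_eqI:
  assumes "\<And>p. e \<le> p \<longleftrightarrow> (\<forall>k\<ge>p. \<not> ends_123 \<sigma> k)"
  shows "first_site \<sigma> = e"
  by (metis assms first_site_le_iff order_antisym order_refl)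

lemma first_site_le_length: "first_site \<sigma> \<le> length \<sigma>"
  by (simp add: first_site_le_iff ends_123_def)

text \<open>The entry just before \<open>first_site\<close> ends a 123, whose first two entries are
  an ascent. Hence, once a 123 is present, every admissible site has an ascent in front of
  it.\<close>

lemma initial_run_less_first_site:
  assumes "first_site \<sigma> \<noteq> 0"
  shows "initial_run \<sigma> < first_site \<sigma>"
proof -
  have "\<not> first_site \<sigma> \<le> first_site \<sigma> - 1" using assms by simp
  then obtain k where k: "k \<ge> first_site \<sigma> - 1" "ends_123 \<sigma> k"
    unfolding first_site_le_iff by blast
  moreover have "\<not> first_site \<sigma> \<le> k" using k(2) first_site_le_iff by blast
  ultimately have "k = first_site \<sigma> - 1" by simp
  with k(2) have "has_ascent \<sigma> (first_site \<sigma>)"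
    using assms unfolding ends_123_def by (elim conjE exE) (rule has_ascentI, auto)
  then show ?thesis using has_ascent_iff first_site_le_length by blast
qed

section \<open>Effect of inserting a new maximum\<close>

context
  fixes \<sigma> :: "nat list" and p x :: nat
  assumes p: "p \<le> length \<sigma>" and x: "\<And>y. y \<in> set \<sigma> \<Longrightarrow> y < x"
begin

lemma nth_less_max: "i < length \<sigma> \<Longrightarrow> \<sigma> ! i < x"
  using x by simp

lemma has_ascent_insert_at_le:
  "q \<le> p \<Longrightarrow> has_ascent (insert_at p x \<sigma>) q \<longleftrightarrow> has_ascent \<sigma> q"
  unfolding has_ascent_def using p by (intro ex_cong1 conj_cong refl) (simp add: nth_insert_at)

lemma has_ascent_insert_at_gr:
  assumes "0 < p" "p < q"
  shows "has_ascent (insert_at p x \<sigma>) q"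
\<comment> \<open>The first entry and the new maximum form the ascent; they are different entries
  because \<open>0 < p\<close>.\<close>
proof (rule has_ascentI[of 0 p])
  have "\<sigma> ! 0 < x" using assms(1) p by (intro nth_less_max) linarith
  then show "insert_at p x \<sigma> ! 0 < insert_at p x \<sigma> ! p" using assms p by (simp add: nth_insert_at)
qed (use assms in auto)

text \<open>The new maximum can only play the 3 of a 123, which it does iff an ascent precedes it.
  It therefore helps no other entry to end a 123, and the entries behind it merely shift by
  one.\<close>

lemma ends_123_insert_at:
  "ends_123 (insert_at p x \<sigma>) k \<longleftrightarrow>
    (if k < p then ends_123 \<sigma> k else if k = p then has_ascent \<sigma> p else ends_123 \<sigma> (k - 1))"
proof -
  consider "k < p" | "k = p" | "k > p" "k > length \<sigma>" | "k > p" "k \<le> length \<sigma>" by linarith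
  then show ?thesis
  proof cases
    case 1
    then have "ends_123 (insert_at p x \<sigma>) k \<longleftrightarrow> ends_123 \<sigma> k"
      unfolding ends_123_def using p
      by (intro ex_cong1 conj_cong refl) (simp_all add: nth_insert_at)
    then show ?thesis using 1 by simp
  next
    case 2
    then have "ends_123 (insert_at p x \<sigma>) k \<longleftrightarrow> k < Suc (length \<sigma>) \<and> has_ascent \<sigma> p"
      unfolding ends_123_def has_ascent_def length_insert_at using p nth_less_max
      by (intro ex_cong1 conj_cong refl) (simp_all add: nth_insert_at)
    then show ?thesis using 2 p by simp
  next
    case 3
    then show ?thesis using p by (auto simp: ends_123_def)
  next
    case 4
    show ?thesis
    proof
      assume "ends_123 (insert_at p x \<sigma>) k"
      then obtain i j where ij: "j < k" "i < j" "insert_at p x \<sigma> ! i < insert_at p x \<sigma> ! j"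
        "insert_at p x \<sigma> ! j < insert_at p x \<sigma> ! k" by (auto simp: ends_123_def)
      have "insert_at p x \<sigma> ! k < x" using 4 p nth_less_max by (auto simp: nth_insert_at)
      \<comment> \<open>The entries at \<open>i\<close> and \<open>j\<close> lie below the entry at
        \<open>k\<close>, hence below the new maximum, so deleting the latter keeps the 123.\<close>
      with ij have "i \<noteq> p" "j \<noteq> p" using 4 p by (auto simp: nth_insert_at)
      with ij 4 p have "ends_123 \<sigma> (k - 1)"
        by (intro ends_123I[of "if i < p then i else i - 1" "if j < p then j else j - 1"])
          (auto simp: nth_insert_at split: if_splits)
      then show "if k < p then ends_123 \<sigma> k else if k = p then has_ascent \<sigma> p else ends_123 \<sigma> (k - 1)"
        using 4 by simp
    next
      assume "if k < p then ends_123 \<sigma> k else if k = p then has_ascent \<sigma> p else ends_123 \<sigma> (k - 1)"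
      with 4(1) obtain i j where ij: "j < k - 1" "i < j" "\<sigma> ! i < \<sigma> ! j" "\<sigma> ! j < \<sigma> ! (k - 1)"
        by (auto simp: ends_123_def)
      with 4 p show "ends_123 (insert_at p x \<sigma>) k"
        by (intro ends_123I[of "if i < p then i else Suc i" "if j < p then j else Suc j"])
          (auto simp: nth_insert_at split: if_splits)
    qed
  qed
qed

text \<open>An end of a 123 at or after \<open>p\<close> would land behind the new maximum and
  exceed it no longer. Ends before \<open>p\<close> keep the same entries in front of them, and the
  new entry is itself a left-to-right maximum.\<close>

lemma ends_maximal_insert_at:
  "ends_maximal (insert_at p x \<sigma>) \<longleftrightarrow> ends_maximal \<sigma> \<and> first_site \<sigma> \<le> p"
proof (intro iffI conjI)
  assume L: "ends_maximal (insert_at p x \<sigma>)"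
  show fs: "first_site \<sigma> \<le> p"
    unfolding first_site_le_iff
  proof (intro allI impI notI)
    fix k assume k: "p \<le> k" "ends_123 \<sigma> k"
    then have "k < length \<sigma>" by (simp add: ends_123_def)
    moreover have "ends_123 (insert_at p x \<sigma>) (Suc k)" using k by (simp add: ends_123_insert_at)
    with L k(1) have "insert_at p x \<sigma> ! p \<le> insert_at p x \<sigma> ! Suc k"
      unfolding ends_maximal_def by (meson le_imp_less_Suc)
    ultimately show False using k nth_less_max[of k] p by (simp add: nth_insert_at)
  qed
  show "ends_maximal \<sigma>"
    unfolding ends_maximal_def
  proof (intro allI impI)
    fix k l assume kl: "ends_123 \<sigma> k" "l < k"
    then have "k < p" using fs first_site_le_iff not_le by blast
    moreover from this kl have "insert_at p x \<sigma> ! l \<le> insert_at p x \<sigma> ! k"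
      using L unfolding ends_maximal_def by (simp add: ends_123_insert_at)
    ultimately show "\<sigma> ! l \<le> \<sigma> ! k" using kl p by (simp add: nth_insert_at)
  qed
next
  assume R: "ends_maximal \<sigma> \<and> first_site \<sigma> \<le> p"
  show "ends_maximal (insert_at p x \<sigma>)"
    unfolding ends_maximal_def
  proof (intro allI impI)
    fix k l assume kl: "ends_123 (insert_at p x \<sigma>) k" "l < k"
    have "\<not> k > p" using R kl(1) unfolding first_site_le_iff ends_123_insert_at by auto
    then consider "k < p" | "k = p" by linarith
    then show "insert_at p x \<sigma> ! l \<le> insert_at p x \<sigma> ! k"
    proof cases
      case 1
      with kl R have "\<sigma> ! l \<le> \<sigma> ! k" by (simp add: ends_123_insert_at ends_maximal_def)
      with 1 kl p show ?thesis by (simp add: nth_insert_at)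
    next
      case 2
      with kl p nth_less_max[of l] show ?thesis by (simp add: nth_insert_at)
    qed
  qed
qed

text \<open>The new maximum becomes the last end of a 123, so the admissible sites are those behind
  it.\<close>

lemma first_site_insert_at_ascent:
  assumes "first_site \<sigma> \<le> p" "has_ascent \<sigma> p"
  shows "first_site (insert_at p x \<sigma>) = Suc p"
proof (rule first_site_eqI)
  fix q
  have "\<not> ends_123 (insert_at p x \<sigma>) k" if "k > p" for k
    using that assms(1) by (auto simp: ends_123_insert_at first_site_le_iff)
  moreover have "ends_123 (insert_at p x \<sigma>) p" using assms by (simp add: ends_123_insert_at)
  ultimately show "Suc p \<le> q \<longleftrightarrow> (\<forall>k\<ge>q. \<not> ends_123 (insert_at p x \<sigma>) k)"
    by (meson Suc_le_lessD less_le_trans not_less_eq_eq)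
qed

lemma first_site_insert_at_no_ascent:
  assumes "first_site \<sigma> = 0" "\<not> has_ascent \<sigma> p"
  shows "first_site (insert_at p x \<sigma>) = 0"
proof -
  have "\<not> ends_123 \<sigma> k" for k using assms(1) first_site_le_iff[of \<sigma> 0] by simp
  then have "first_site (insert_at p x \<sigma>) \<le> 0"
    unfolding first_site_le_iff using assms(2) by (simp add: ends_123_insert_at)
  then show ?thesis by simp
qed

text \<open>The new maximum rises above the decreasing prefix before it and so cuts the initial run
  off at \<open>p\<close>.\<close>

lemma initial_run_insert_at:
  assumes "0 < p" "\<not> has_ascent \<sigma> p"
  shows "initial_run (insert_at p x \<sigma>) = p"
proof (rule initial_run_eqI)
  show "p \<le> length (insert_at p x \<sigma>)" using p by simp
  fix q
  show "has_ascent (insert_at p x \<sigma>) q \<longleftrightarrow> p < q"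
    using assms has_ascent_insert_at_le has_ascent_insert_at_gr has_ascent_mono not_le by blast
qed

end

text \<open>At the front the new maximum takes part in no ascent, so it prolongs the run instead of
  cutting it.\<close>

lemma initial_run_insert_at_0:
  assumes x: "\<And>y. y \<in> set \<sigma> \<Longrightarrow> y < x"
  shows "initial_run (insert_at 0 x \<sigma>) = Suc (initial_run \<sigma>)"
proof (rule initial_run_eqI)
  show "Suc (initial_run \<sigma>) \<le> length (insert_at 0 x \<sigma>)" by (simp add: initial_run_le)
  fix q assume q: "q \<le> length (insert_at 0 x \<sigma>)"
  show "has_ascent (insert_at 0 x \<sigma>) q \<longleftrightarrow> Suc (initial_run \<sigma>) < q"
  proof (cases q)
    case (Suc m)
    have "has_ascent (insert_at 0 x \<sigma>) (Suc m) \<longleftrightarrow> has_ascent \<sigma> m"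
    proof
      assume "has_ascent (insert_at 0 x \<sigma>) (Suc m)"
      then obtain i j where ij: "j < Suc m" "i < j"
        "insert_at 0 x \<sigma> ! i < insert_at 0 x \<sigma> ! j" by (auto simp: has_ascent_def)
      have "i \<noteq> 0"
      proof
        assume "i = 0"
        then have "x < \<sigma> ! (j - 1)" using ij q Suc by (simp add: nth_insert_at)
        moreover have "\<sigma> ! (j - 1) < x" using x ij q Suc by auto
        ultimately show False by simp
      qed
      with ij q Suc show "has_ascent \<sigma> m"
        by (intro has_ascentI[of "i - 1" "j - 1"]) (auto simp: nth_insert_at)
    next
      assume "has_ascent \<sigma> m"
      then obtain i j where ij: "j < m" "i < j" "\<sigma> ! i < \<sigma> ! j" by (auto simp: has_ascent_def)
      with q Suc show "has_ascent (insert_at 0 x \<sigma>) (Suc m)"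
        by (intro has_ascentI[of "Suc i" "Suc j"]) (auto simp: nth_insert_at)
    qed
    then show ?thesis using q Suc has_ascent_iff by simp
  qed (simp add: has_ascent_def)
qed

section \<open>The levels of the generating tree and their sizes\<close>

lemma set_perms: "\<sigma> \<in> perms n \<Longrightarrow> set \<sigma> = {1..n}"
  by (simp add: perms_def permutations_of_set_def)

lemma length_perms: "\<sigma> \<in> perms n \<Longrightarrow> length \<sigma> = n"
  by (simp add: perms_def length_finite_permutations_of_set)

lemma finite_perms: "finite (perms n)"
  by (simp add: perms_def)

lemma insert_at_perms:
  "insert_at p (Suc n) \<sigma> \<in> perms (Suc n)" if "\<sigma> \<in> perms n"
proof -
  define us vs where "us = take p \<sigma>" and "vs = drop p \<sigma>"
  then have eq: "insert_at p (Suc n) \<sigma> = us @ Suc n # vs" "\<sigma> = us @ vs"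
    by (simp_all add: insert_at_def)
  have d: "distinct (us @ vs)" "set us \<union> set vs = {1..n}"
    using that eq(2) by (auto simp: perms_def permutations_of_set_def)
  then have "Suc n \<notin> set us \<union> set vs" unfolding d(2) by simp
  with d(1) have "distinct (us @ Suc n # vs)" by auto
  moreover have "set (us @ Suc n # vs) = insert (Suc n) (set us \<union> set vs)" by simp
  then have "set (us @ Suc n # vs) = {1..Suc n}"
    unfolding d(2) by (simp add: atLeastAtMostSuc_conv)
  ultimately show ?thesis unfolding eq(1) by (simp add: perms_def permutations_of_set_def)
qed

lemma perms_SucE:
  assumes "\<tau> \<in> perms (Suc n)"
  obtains \<sigma> p where "\<sigma> \<in> perms n" "p \<le> n" "\<tau> = insert_at p (Suc n) \<sigma>"
proof -
  have d: "distinct \<tau>" "set \<tau> = {1..Suc n}"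
    using assms by (auto simp: perms_def permutations_of_set_def)
  then obtain us vs where \<tau>: "\<tau> = us @ Suc n # vs"
    by (metis atLeastAtMost_iff le_add1 plus_1_eq_Suc order_refl split_list)
  have "set (us @ vs) = set \<tau> - {Suc n}" using d(1) \<tau> by auto
  also have "\<dots> = {1..n}" unfolding d(2) by (simp add: atLeastAtMostSuc_conv)
  finally have "us @ vs \<in> perms n" using d(1) \<tau> by (simp add: perms_def permutations_of_set_def)
  moreover from this have "length us \<le> n" using length_perms by fastforce
  ultimately show thesis using that[of "us @ vs" "length us"] \<tau> by (simp add: insert_at_def)
qed

definition maximal_perms :: "nat \<Rightarrow> nat list set" where
  "maximal_perms n = {\<sigma> \<in> perms n. ends_maximal \<sigma>}"

text \<open>Deleting the entry \<open>Suc n\<close> recovers the parent and the site, and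
  \<open>ends_maximal_insert_at\<close> says which sites are admissible.\<close>

lemma maximal_perms_Suc:
  "bij_betw (\<lambda>(\<sigma>, p). insert_at p (Suc n) \<sigma>)
     (SIGMA \<sigma>:maximal_perms n. {first_site \<sigma>..n}) (maximal_perms (Suc n))"
  unfolding bij_betw_def
proof
  show "inj_on (\<lambda>(\<sigma>, p). insert_at p (Suc n) \<sigma>) (SIGMA \<sigma>:maximal_perms n. {first_site \<sigma>..n})"
  proof (rule inj_onI, clarify)
    fix \<sigma> p \<sigma>' p'
    assume h: "\<sigma> \<in> maximal_perms n" "\<sigma>' \<in> maximal_perms n" "p \<in> {first_site \<sigma>..n}"
      "p' \<in> {first_site \<sigma>'..n}" "insert_at p (Suc n) \<sigma> = insert_at p' (Suc n) \<sigma>'"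
    have \<sigma>: "set \<sigma> = {1..n}" "length \<sigma> = n" "length \<sigma>' = n"
      using h set_perms length_perms by (auto simp: maximal_perms_def)
    then have "Suc n \<notin> set (take p \<sigma>)" "Suc n \<notin> set (drop p \<sigma>)"
      by (auto dest: in_set_takeD in_set_dropD)
    \<comment> \<open>\<open>Suc n\<close> does not occur in \<sigma>, so the list can be split
      around it in one way only.\<close>
    with h(5) have "take p \<sigma> = take p' \<sigma>'" "drop p \<sigma> = drop p' \<sigma>'"
      by (auto simp: insert_at_def append_Cons_eq_iff)
    moreover from this(1) have "p = p'" using \<sigma> h(3,4)
      by (metis atLeastAtMost_iff length_take min.absorb2)
    ultimately show "\<sigma> = \<sigma>' \<and> p = p'" by (metis append_take_drop_id)
  qed
  have max: "y < Suc n" if "\<sigma> \<in> perms n" "y \<in> set \<sigma>" for \<sigma> y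
    using that set_perms by fastforce
  have *: "insert_at p (Suc n) \<sigma> \<in> maximal_perms (Suc n) \<longleftrightarrow>
      \<sigma> \<in> maximal_perms n \<and> first_site \<sigma> \<le> p" if "\<sigma> \<in> perms n" "p \<le> n" for \<sigma> p
    using ends_maximal_insert_at[of p \<sigma> "Suc n"] max that length_perms insert_at_perms
    by (auto simp: maximal_perms_def)
  show "(\<lambda>(\<sigma>, p). insert_at p (Suc n) \<sigma>) ` (SIGMA \<sigma>:maximal_perms n. {first_site \<sigma>..n}) =
      maximal_perms (Suc n)" (is "?L = ?R")
  proof
    show "?L \<subseteq> ?R"
    proof clarify
      fix \<sigma> p assume "\<sigma> \<in> maximal_perms n" "p \<in> {first_site \<sigma>..n}"
      then show "insert_at p (Suc n) \<sigma> \<in> maximal_perms (Suc n)"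
        using *[of \<sigma> p] by (simp add: maximal_perms_def)
    qed
    show "?R \<subseteq> ?L"
    proof
      fix \<tau> assume \<tau>: "\<tau> \<in> ?R"
      then obtain \<sigma> p where \<sigma>: "\<sigma> \<in> perms n" "p \<le> n" "\<tau> = insert_at p (Suc n) \<sigma>"
        by (auto simp: maximal_perms_def elim: perms_SucE)
      then have "(\<sigma>, p) \<in> (SIGMA \<sigma>:maximal_perms n. {first_site \<sigma>..n})" using * \<tau> by simp
      then show "\<tau> \<in> ?L" using \<sigma>(3) by force
    qed
  qed
qed

text \<open>The equation for \<open>W\<close> says that each node counts itself and, shifted by one,
  whatever its children count. Comparing coefficients turns coefficient \<open>Suc t\<close> over
  level \<open>m\<close> into coefficient \<open>t\<close> over level \<open>Suc m\<close>, so no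
  explicit notion of descendant is required.\<close>

lemma card_maximal_perms_eq_sum:
  fixes W :: "nat list \<Rightarrow> real fps"
  assumes W: "\<And>n \<sigma>. \<sigma> \<in> perms n \<Longrightarrow>
    W \<sigma> = 1 + fps_X * (\<Sum>p=first_site \<sigma>..n. W (insert_at p (Suc n) \<sigma>))"
  shows "(\<Sum>\<sigma>\<in>maximal_perms m. fps_nth (W \<sigma>) t) = card (maximal_perms (m + t))"
proof (induction t arbitrary: m)
  case 0
  have "fps_nth (W \<sigma>) 0 = 1" if "\<sigma> \<in> maximal_perms m" for \<sigma>
    using that by (subst W[of _ m]) (auto simp: maximal_perms_def)
  then show ?case by simp
next
  case (Suc t)
  have "(\<Sum>\<sigma>\<in>maximal_perms m. fps_nth (W \<sigma>) (Suc t)) =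
      (\<Sum>\<sigma>\<in>maximal_perms m. \<Sum>p=first_site \<sigma>..m. fps_nth (W (insert_at p (Suc m) \<sigma>)) t)"
    by (intro sum.cong refl, subst W[of _ m]) (auto simp: maximal_perms_def fps_sum_nth)
  also have "\<dots> = (\<Sum>(\<sigma>, p)\<in>(SIGMA \<sigma>:maximal_perms m. {first_site \<sigma>..m}).
      fps_nth (W (insert_at p (Suc m) \<sigma>)) t)"
    by (rule sum.Sigma) (auto simp: maximal_perms_def finite_perms)
  also have "\<dots> = (\<Sum>\<tau>\<in>maximal_perms (Suc m). fps_nth (W \<tau>) t)"
    using sum.reindex_bij_betw[OF maximal_perms_Suc, of "\<lambda>\<tau>. fps_nth (W \<tau>) t" m]
    by (simp add: case_prod_unfold)
  also have "\<dots> = card (maximal_perms (m + Suc t))" using Suc.IH[of "Suc m"] by simp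
  finally show ?case .
qed

lemma perm_gf_eq:
  "perm_gf (Av {[4,1,2,3], [1,2,4,3], [1,4,2,3]}) = Abs_fps (\<lambda>n. of_nat (card (maximal_perms n)))"
proof -
  have "perms n \<inter> Av {[4,1,2,3], [1,2,4,3], [1,4,2,3]} = maximal_perms n" for n
    unfolding Av_def maximal_perms_def ends_maximal_iff_avoids by blast
  then show ?thesis by (simp add: perm_gf_def)
qed

section \<open>Weights of the nodes and their recurrence\<close>

lemma geometric_sum_fps:
  fixes y :: "real fps"
  assumes "y * (1 - fps_X) = 1"
  shows "1 + fps_X * (\<Sum>i=1..s. y ^ i) = y ^ s"
proof (induction s)
  case (Suc s)
  have "1 + fps_X * (\<Sum>i=1..Suc s. y ^ i) = y ^ s + fps_X * y ^ Suc s"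
    using Suc by (simp add: algebra_simps)
  \<comment> \<open>The factor 1 of \<open>y ^ s\<close> is expanded to
    \<open>y * (1 - fps_X)\<close>.\<close>
  also have "\<dots> = y ^ s * (y * (1 - fps_X) + fps_X * y)"
    unfolding assms by (simp add: algebra_simps)
  also have "\<dots> = y ^ Suc s" by (simp add: algebra_simps)
  finally show ?case .
qed simp

lemma sum_atLeastAtMost_flip:
  fixes f :: "nat \<Rightarrow> 'a :: comm_monoid_add"
  assumes "m \<le> Suc n"
  shows "(\<Sum>p=m..n. f (Suc n - p)) = (\<Sum>i=1..Suc n - m. f i)"
  by (rule sum.reindex_bij_witness[of _ "\<lambda>i. Suc n - i" "\<lambda>p. Suc n - p"]) (use assms in auto)

text \<open>The generating function of all descendants of \<open>\<sigma>\<close> in the generating tree, by additional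
  length.\<close>
definition weight :: "real fps \<Rightarrow> (nat \<Rightarrow> real fps) \<Rightarrow> nat list \<Rightarrow> real fps" where
  "weight y H \<sigma> = (if first_site \<sigma> = 0 then y ^ (length \<sigma> - initial_run \<sigma>) * H (initial_run \<sigma>)
     else y ^ (Suc (length \<sigma>) - first_site \<sigma>))"

text \<open>With a 123 present, the children have weights \<open>y\<close>, ...,
  \<open>y ^ s\<close> for \<open>s\<close> admissible sites, a geometric sum. Without one, let
  \<open>r\<close> be the initial run: site 0 lengthens the run to \<open>Suc r\<close>, a site
  \<open>p\<close> in \<open>1..r\<close> shortens it to \<open>p\<close>, and a site beyond
  \<open>r\<close> creates a 123. The last kind, together with the node itself, contributes
  \<open>y ^ (n - r)\<close>; this is a common factor, and the recurrence for \<open>H\<close>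
  remains.\<close>

lemma weight_eq_sum_children:
  assumes y: "y * (1 - fps_X) = 1"
    and H: "\<And>r. H r = 1 + fps_X * (H (Suc r) + (\<Sum>p=1..r. y ^ (Suc r - p) * H p))"
    and \<sigma>: "\<sigma> \<in> perms n"
  shows "weight y H \<sigma> = 1 + fps_X * (\<Sum>p=first_site \<sigma>..n. weight y H (insert_at p (Suc n) \<sigma>))"
proof -
  have len: "length \<sigma> = n" using length_perms \<sigma> by blast
  have max: "z < Suc n" if "z \<in> set \<sigma>" for z using that set_perms[OF \<sigma>] by auto
  have asc: "weight y H (insert_at p (Suc n) \<sigma>) = y ^ (Suc n - p)"
    if "first_site \<sigma> \<le> p" "p \<le> n" "initial_run \<sigma> < p" for p
  proof -
    have "first_site (insert_at p (Suc n) \<sigma>) = Suc p"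
      using that len max has_ascent_iff by (intro first_site_insert_at_ascent) auto
    then show ?thesis using len by (simp add: weight_def)
  qed
  show ?thesis
  proof (cases "first_site \<sigma> = 0")
    case False
    then have r: "initial_run \<sigma> < first_site \<sigma>" by (rule initial_run_less_first_site)
    have "(\<Sum>p=first_site \<sigma>..n. weight y H (insert_at p (Suc n) \<sigma>)) =
        (\<Sum>p=first_site \<sigma>..n. y ^ (Suc n - p))"
      using r by (intro sum.cong refl asc) auto
    also have "\<dots> = (\<Sum>i=1..Suc n - first_site \<sigma>. y ^ i)"
      using first_site_le_length[of \<sigma>] len by (intro sum_atLeastAtMost_flip) simp
    finally show ?thesis using False len geometric_sum_fps[OF y] by (simp add: weight_def)
  next
    case True
    define r where "r = initial_run \<sigma>"
    have r: "r \<le> n" using initial_run_le[of \<sigma>] len r_def by simp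
    have no: "\<not> has_ascent \<sigma> p" if "p \<le> r" for p
      using that has_ascent_iff[of p \<sigma>] r len by (simp add: r_def)
    have c0: "weight y H (insert_at 0 (Suc n) \<sigma>) = y ^ (n - r) * H (Suc r)"
      using first_site_insert_at_no_ascent[of 0 \<sigma> "Suc n"] initial_run_insert_at_0[of \<sigma> "Suc n"]
        True max no len by (simp add: weight_def r_def)
    have c1: "weight y H (insert_at p (Suc n) \<sigma>) = y ^ (n - r) * (y ^ (Suc r - p) * H p)"
      if "1 \<le> p" "p \<le> r" for p
    proof -
      have "first_site (insert_at p (Suc n) \<sigma>) = 0"
        using that True max no len r by (intro first_site_insert_at_no_ascent) auto
      moreover have "initial_run (insert_at p (Suc n) \<sigma>) = p"
        using that max no len r by (intro initial_run_insert_at) auto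
      \<comment> \<open>Splitting the exponent at \<open>r\<close> exposes the factor
        \<open>y ^ (n - r)\<close> shared by all children.\<close>
      moreover have "Suc n - p = (n - r) + (Suc r - p)" using that r by simp
      ultimately show ?thesis using len by (simp add: weight_def power_add del: diff_Suc)
    qed
    have split: "{0..n} = insert 0 ({1..r} \<union> {Suc r..n})" using r by auto
    have "(\<Sum>p=first_site \<sigma>..n. weight y H (insert_at p (Suc n) \<sigma>)) =
        weight y H (insert_at 0 (Suc n) \<sigma>) + (\<Sum>p=1..r. weight y H (insert_at p (Suc n) \<sigma>)) +
        (\<Sum>p=Suc r..n. weight y H (insert_at p (Suc n) \<sigma>))"
      unfolding True split by (subst sum.insert; (subst sum.union_disjoint)?) (auto simp: add.assoc)
    also have "(\<Sum>p=1..r. weight y H (insert_at p (Suc n) \<sigma>)) =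
        y ^ (n - r) * (\<Sum>p=1..r. y ^ (Suc r - p) * H p)"
      unfolding sum_distrib_left by (intro sum.cong refl c1) auto
    also have "(\<Sum>p=Suc r..n. weight y H (insert_at p (Suc n) \<sigma>)) = (\<Sum>p=Suc r..n. y ^ (Suc n - p))"
      by (intro sum.cong refl asc) (auto simp: True r_def)
    also have "\<dots> = (\<Sum>i=1..n - r. y ^ i)"
      using r sum_atLeastAtMost_flip[of "Suc r" n "\<lambda>i. y ^ i"] by simp
    finally have "1 + fps_X * (\<Sum>p=first_site \<sigma>..n. weight y H (insert_at p (Suc n) \<sigma>)) =
        (1 + fps_X * (\<Sum>i=1..n - r. y ^ i)) +
        y ^ (n - r) * (fps_X * (H (Suc r) + (\<Sum>p=1..r. y ^ (Suc r - p) * H p)))"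
      unfolding c0 by (simp add: algebra_simps)
    also have "\<dots> = y ^ (n - r) * (1 + fps_X * (H (Suc r) + (\<Sum>p=1..r. y ^ (Suc r - p) * H p)))"
      unfolding geometric_sum_fps[OF y] by (simp only: distrib_left mult_1_right)
    also have "\<dots> = y ^ (n - r) * H r" using H[of r] by simp
    finally show ?thesis using True len by (simp add: weight_def r_def)
  qed
qed

lemma perm_gf_eq_root_weight:
  assumes y: "y * (1 - fps_X) = 1"
    and H: "\<And>r. H r = 1 + fps_X * (H (Suc r) + (\<Sum>p=1..r. y ^ (Suc r - p) * H p))"
  shows "perm_gf (Av {[4,1,2,3], [1,2,4,3], [1,4,2,3]}) = H 0"
proof (rule fps_ext)
  fix n
  have nil: "ends_maximal []" "first_site [] = 0" "initial_run [] = 0"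
    using first_site_le_length[of "[]"] initial_run_le[of "[]"]
    by (auto simp: ends_maximal_def ends_123_def)
  then have "maximal_perms 0 = {[]}" by (auto simp: maximal_perms_def perms_def)
  \<comment> \<open>Counting starts at the root, the empty permutation, whose weight is
    \<open>H 0\<close>.\<close>
  moreover have "(\<Sum>\<sigma>\<in>maximal_perms 0. fps_nth (weight y H \<sigma>) n) = card (maximal_perms (0 + n))"
    by (intro card_maximal_perms_eq_sum weight_eq_sum_children y H)
  ultimately show "fps_nth (perm_gf (Av {[4,1,2,3], [1,2,4,3], [1,4,2,3]})) n = fps_nth (H 0) n"
    unfolding perm_gf_eq by (simp add: weight_def nil)
qed

text \<open>Passing from \<open>r\<close> to \<open>Suc r\<close> multiplies the sum by
  \<open>y\<close> after adding \<open>H (Suc r)\<close> to it. This eliminates the sum and leaves a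
  linear recurrence of order two: \<open>k\<close> is its constant solution, \<open>q ^ r\<close>
  solves the homogeneous part, and \<open>c\<close> is fitted to the equation at
  \<open>r = 0\<close>.\<close>

lemma catalan_tree_solution:
  fixes y q k c :: "real fps"
  defines "H \<equiv> \<lambda>r. k * (1 + c * q ^ r)"
  assumes y: "y * (1 - fps_X) = 1" and q: "q = y + fps_X * q ^ 2"
    and k: "k * (2 - fps_X) = 1" and c: "c * (1 - fps_X * q) = 1"
  shows "H r = 1 + fps_X * (H (Suc r) + (\<Sum>p=1..r. y ^ (Suc r - p) * H p))"
proof (induction r)
  case 0
  show ?case unfolding H_def using k c by (simp, algebra)
next
  case (Suc r)
  have "(\<Sum>p=1..Suc r. y ^ (Suc (Suc r) - p) * H p) =
      y * ((\<Sum>p=1..r. y ^ (Suc r - p) * H p) + H (Suc r))"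
    by (auto simp: sum_distrib_left distrib_left Suc_diff_le algebra_simps intro!: sum.cong)
  moreover have "H (Suc r) = y * H r + 1 - y + fps_X * H (Suc (Suc r))"
  proof -
    have "k * (1 - y) = 1 - y + fps_X * k" using k y by algebra
    moreover have "k * c * q ^ r * q = k * c * q ^ r * (y + fps_X * q ^ 2)" using q by simp
    ultimately show ?thesis unfolding H_def by (simp add: algebra_simps power2_eq_square)
  qed
  ultimately show ?case using Suc by algebra
qed

section \<open>The closed form\<close>

theorem theorem3p1:
  shows "perm_gf (Av {[4,1,2,3], [1,2,4,3], [1,4,2,3]}) =
    (1 + fps_X - fps_sqrt (1 - 6 * fps_X + 5 * fps_X ^ 2)) / (2 * (2 * fps_X - fps_X ^ 2))"
proof -
  define S :: "real fps" where "S = fps_sqrt (1 - 6 * fps_X + 5 * fps_X ^ 2)"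
  have S2: "S ^ 2 = 1 - 6 * fps_X + 5 * fps_X ^ 2"
    unfolding S_def by (rule fps_sqrt_power2) simp
  have S0: "fps_nth S 0 = 1" by (simp add: S_def fps_sqrt_def)
  define y k :: "real fps" where "y = inverse (1 - fps_X)" and "k = inverse (2 - fps_X)"
  have y: "y * (1 - fps_X) = 1" unfolding y_def by (rule inverse_mult_eq_1) simp
  have k: "k * (2 - fps_X) = 1" unfolding k_def by (rule inverse_mult_eq_1) simp
  have y0: "fps_nth y 0 = 1" by (simp add: y_def)
  \<comment> \<open>The quadratic \<open>q = y + fps_X * q ^ 2\<close> has discriminant
    \<open>1 - 4 * fps_X * y\<close>, whose square root is \<open>y * S\<close>. The minus sign
    makes the constant term of \<open>1 - y * S\<close> vanish, so the shift divides by
    \<open>fps_X\<close> exactly.\<close>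
  define q :: "real fps" where "q = fps_shift 1 (fps_const (1/2) * (1 - y * S))"
  have Xq': "fps_X * q = fps_const (1/2) * (1 - y * S)"
    unfolding q_def
    by (rule fps_ext) (simp add: fps_X_mult_nth y0 S0)
  have Xq: "2 * (fps_X * q) = 1 - y * S"
  proof -
    have "2 * fps_const (1/2 :: real) = 1" by (simp add: numeral_fps_const)
    then show ?thesis unfolding Xq' by (metis mult.assoc mult_1)
  qed
  \<comment> \<open>The radicand factors as \<open>(1 - fps_X) * (1 - 5 * fps_X)\<close>.\<close>
  have yS2: "y * S ^ 2 = 1 - 5 * fps_X"
  proof -
    have "y * S ^ 2 = y * (1 - fps_X) * (1 - 5 * fps_X)"
      unfolding S2 by (simp add: algebra_simps power2_eq_square)
    then show ?thesis unfolding y by simp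
  qed
  have ySX: "y * S - fps_X * (y * S) = S"
  proof -
    have "y * S - fps_X * (y * S) = y * (1 - fps_X) * S" by (simp add: algebra_simps)
    then show ?thesis unfolding y by simp
  qed
  \<comment> \<open>The quadratic is checked after multiplication by \<open>4 * fps_X\<close>, where
    \<open>q\<close> enters only through \<open>2 * (fps_X * q)\<close>.\<close>
  have "4 * fps_X * (y + fps_X * q ^ 2) = 4 * fps_X * y + (2 * (fps_X * q)) ^ 2"
    by (simp add: algebra_simps power2_eq_square)
  also have "\<dots> = 4 * fps_X * y + 1 - 2 * (y * S) + y * (y * S ^ 2)"
    unfolding Xq by (simp add: algebra_simps power2_eq_square)
  also have "\<dots> = y * (1 - fps_X) + 1 - 2 * (y * S)"
    unfolding yS2 by (simp add: algebra_simps)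
  also have "\<dots> = 2 * (2 * (fps_X * q))" unfolding y Xq by simp
  finally have "4 * fps_X * q = 4 * fps_X * (y + fps_X * q ^ 2)" by simp
  then have q: "q = y + fps_X * q ^ 2" by simp
  define c where "c = inverse (1 - fps_X * q)"
  have c: "c * (1 - fps_X * q) = 1" unfolding c_def by (rule inverse_mult_eq_1) simp
  have "perm_gf (Av {[4,1,2,3], [1,2,4,3], [1,4,2,3]}) = k * (1 + c * q ^ 0)"
    using perm_gf_eq_root_weight[OF y catalan_tree_solution[OF y q k c]] .
  \<comment> \<open>Since \<open>k\<close> cancels \<open>2 - fps_X\<close>, this amounts to
    \<open>1 + fps_X - S = 2 * fps_X * (1 + c)\<close>. That is proved by multiplying with
    \<open>c * (1 + y * S)\<close>, which equals 2.\<close>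
  moreover have "k * (1 + c * q ^ 0) * (2 * (2 * fps_X - fps_X ^ 2)) = 1 + fps_X - S"
  proof -
    have c2: "c * (1 + y * S) = 2"
    proof -
      have "c * (1 + y * S) = c * (2 - 2 * (fps_X * q))" unfolding Xq by simp
      also have "\<dots> = 2 * (c * (1 - fps_X * q))" by (simp add: algebra_simps)
      finally show ?thesis unfolding c by simp
    qed
    have "(1 + fps_X - S) * (1 + y * S) =
        1 + fps_X - S + (y * S - fps_X * (y * S)) + 2 * fps_X * (y * S) - y * S ^ 2"
      by (simp add: algebra_simps power2_eq_square)
    also have "\<dots> = 4 * fps_X + 2 * fps_X * (1 + y * S)"
      unfolding ySX yS2 by (simp add: algebra_simps)
    finally have *: "(1 + fps_X - S) * (1 + y * S) = 4 * fps_X + 2 * fps_X * (1 + y * S)" .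
    have "(1 + fps_X - S) * (c * (1 + y * S)) = c * ((1 + fps_X - S) * (1 + y * S))"
      by (simp only: ac_simps)
    also have "\<dots> = 4 * fps_X * c + 2 * fps_X * (c * (1 + y * S))"
      unfolding * by (simp only: distrib_left ac_simps)
    finally have "(1 + fps_X - S) * (c * (1 + y * S)) =
        4 * fps_X * c + 2 * fps_X * (c * (1 + y * S))" .
    then have "(1 + fps_X - S) * 2 = (2 * fps_X * (1 + c)) * 2"
      unfolding c2 by (simp add: algebra_simps)
    then have "1 + fps_X - S = 2 * fps_X * (1 + c)"
      by (rule mult_right_cancel[THEN iffD1, rotated]) simp
    also have "\<dots> = (k * (2 - fps_X)) * (2 * fps_X * (1 + c))" unfolding k by simp
    also have "\<dots> = k * (1 + c * q ^ 0) * (2 * (2 * fps_X - fps_X ^ 2))"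
      by (simp add: algebra_simps power2_eq_square)
    finally show ?thesis ..
  qed
  ultimately have "perm_gf (Av {[4,1,2,3], [1,2,4,3], [1,4,2,3]}) *
      (2 * (2 * fps_X - fps_X ^ 2)) = 1 + fps_X - S" by simp
  \<comment> \<open>The product with the nonzero denominator is known, so the truncating division
    returns the other factor.\<close>
  then show ?thesis
    using fps_quotient_exact(1) unfolding S_def by (metis nonzero_mult_div_cancel_right)
qed

end
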